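(* Let $q$ be a prime power and let $S$ be a set of $q+1$ points in $\mathrm{PG}(2,q)$. If $S$ has degree at most $3$, then $u_0(S)\ge q(q-2)/3$. If $S$ has degree at most $4$ and $u_3(S)=c$, then $u_0(S)\ge (q^2-3q+2c)/4$.
   Context: $\mathrm{PG}(2,q)$ is the projective plane over $\mathbb{F}_q$. For a set $S$ of $q+1$ points, $u_i(S)$ is the number of lines of $\mathrm{PG}(2,q)$ containing exactly $i$ points of $S$, and the degree of $S$ is the largest $i$ with $u_i(S)\neq 0$. *)

theory Defs
  imports "HOL-Analysis.Analysis"
begin

text \<open>PG(2,q) is modelled on the type \<open>'a ^ 3\<close> over a finite field \<open>'a\<close> with q elements;
  a point \<open>P\<close> lies on a line \<open>L\<close> iff \<open>P \<subseteq> L\<close>.\<close>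

definition pg_points :: "(('a::field) ^ 3) set set" where
  "pg_points = {P. vec.subspace P \<and> vec.dim P = 1}"

definition pg_lines :: "(('a::field) ^ 3) set set" where
  "pg_lines = {L. vec.subspace L \<and> vec.dim L = 2}"

definition num_secants :: "nat \<Rightarrow> (('a::field) ^ 3) set set \<Rightarrow> nat" where
  "num_secants i S = card {L \<in> pg_lines. card {P \<in> S. P \<subseteq> L} = i}"

definition pg_degree :: "(('a::field) ^ 3) set set \<Rightarrow> nat" where
  "pg_degree S = Max {i. num_secants i S \<noteq> 0}"

end

theory Submission
  imports Defs
begin

text \<open>If no line meets \<open>S\<close> in more than \<open>k\<close> points, then summing \<open>(1 - i)(k - i) = k - k i + i(i - 1)\<close>
  with \<open>i = |S \<inter> L|\<close> over all lines \<open>L\<close> counts lines, flags and pairs of points, so it yields a number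
  depending only on \<open>q\<close>, \<open>k\<close> and \<open>|S|\<close>. The summand is \<open>k\<close> at \<open>i = 0\<close> and vanishes at \<open>i = 1\<close> and
  \<open>i = k\<close>, which expresses \<open>k u\<^sub>0\<close> as that number plus a nonnegative combination of
  \<open>u\<^sub>2, \<dots>, u\<^sub>k\<^sub>-\<^sub>1\<close>.\<close>

subsection \<open>Subspaces of vector spaces over finite fields\<close>

lemma (in vector_space) card_span_insert:
  assumes "a \<notin> span B"
  shows "card (span (insert a B)) = CARD('a) * card (span B)"
proof -
  let ?f = "\<lambda>(c, x). c *s a + x"
  have "span (insert a B) = ?f ` (UNIV \<times> span B)"
  proof (intro equalityI subsetI)
    fix x assume "x \<in> span (insert a B)"
    then obtain c where "x - c *s a \<in> span B"
      by (auto simp: span_breakdown_eq)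
    then show "x \<in> ?f ` (UNIV \<times> span B)"
      by (intro image_eqI[of _ _ "(c, x - c *s a)"]) auto
  next
    fix x assume "x \<in> ?f ` (UNIV \<times> span B)"
    then obtain c y where "y \<in> span B" "x = c *s a + y" by auto
    then have "x - c *s a \<in> span B" by simp
    then show "x \<in> span (insert a B)" by (auto simp: span_breakdown_eq)
  qed
  moreover have "inj_on ?f (UNIV \<times> span B)"
  proof (rule inj_onI, clarsimp)
    fix c x d y
    assume x: "x \<in> span B" and y: "y \<in> span B" and eq: "c *s a + x = d *s a + y"
    then have "(c - d) *s a = y - x"
      by (simp add: scale_left_diff_distrib algebra_simps)
    then have "(c - d) *s a \<in> span B" using x y by (simp add: span_diff)
    then have "inverse (c - d) *s ((c - d) *s a) \<in> span B" by (rule span_scale)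
    then have "c = d" using \<open>a \<notin> span B\<close> by (cases "c = d") simp_all
    then show "c = d \<and> x = y" using eq by simp
  qed
  ultimately show ?thesis by (simp add: card_image card_cartesian_product)
qed

lemma (in vector_space) card_span_independent:
  assumes "finite B" "independent B"
  shows "card (span B) = CARD('a) ^ card B"
  using assms by induction (simp_all add: independent_insert card_span_insert)

context finite_dimensional_vector_space
begin

lemma card_subspace:
  assumes "subspace V"
  shows "card V = CARD('a) ^ dim V"
proof -
  obtain B where B: "B \<subseteq> V" "independent B" "V \<subseteq> span B" "card B = dim V"
    by (rule basis_exists)
  then have "V = span B" using assms span_minimal by blast
  then show ?thesis
    using card_span_independent[OF finiteI_independent[OF B(2)] B(2)] B(4) by simp
qed

lemma subspace_eq_span_independent:
  assumes "subspace V" "B \<subseteq> V" "independent B" "card B = dim V"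
  shows "V = span B"
  using card_eq_dim[of B V] finiteI_independent span_minimal assms by blast

lemma one_dim_subspace_eq_span:
  assumes "subspace P" "dim P = 1" "v \<in> P" "v \<noteq> 0"
  shows "P = span {v}"
  using assms by (intro subspace_eq_span_independent) auto

lemma one_dim_subspaceE:
  assumes "subspace P" "dim P = 1"
  obtains v where "v \<noteq> 0" "P = span {v}"
proof -
  have "\<not> P \<subseteq> {0}" using assms(2) dim_eq_0[of P] by linarith
  then show ?thesis using one_dim_subspace_eq_span[OF assms] that by blast
qed

lemma ex1_two_dim_subspace:
  assumes P: "subspace P" "dim P = 1" and Q: "subspace Q" "dim Q = 1" and "P \<noteq> Q"
  shows "\<exists>!L. subspace L \<and> dim L = 2 \<and> P \<subseteq> L \<and> Q \<subseteq> L"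
proof -
  obtain v where v: "v \<noteq> 0" "P = span {v}" using P by (rule one_dim_subspaceE)
  obtain w where w: "w \<noteq> 0" "Q = span {w}" using Q by (rule one_dim_subspaceE)
  have "w \<notin> P" using one_dim_subspace_eq_span[OF P _ w(1)] w(2) \<open>P \<noteq> Q\<close> by blast
  then have ind: "independent {w, v}" and "w \<noteq> v"
    using v by (auto simp: independent_insert span_base)
  then have card_pair: "card {w, v} = 2" by simp
  have subset_iff: "P \<subseteq> L \<and> Q \<subseteq> L \<longleftrightarrow> {w, v} \<subseteq> L" if "subspace L" for L
    using that v(2) w(2) span_minimal[of _ L] span_superset by blast
  show ?thesis
  proof (rule ex1I)
    show "subspace (span {w, v}) \<and> dim (span {w, v}) = 2 \<and> P \<subseteq> span {w, v} \<and> Q \<subseteq> span {w, v}"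
      using subset_iff[of "span {w, v}"] span_superset[of "{w, v}"] dim_eq_card_independent[OF ind]
        card_pair by simp
  next
    fix L assume L: "subspace L \<and> dim L = 2 \<and> P \<subseteq> L \<and> Q \<subseteq> L"
    then have "{w, v} \<subseteq> L" using subset_iff by blast
    then show "L = span {w, v}"
      using L ind card_pair by (intro subspace_eq_span_independent) simp_all
  qed
qed

lemma card_one_dim_subspaces_mult:
  assumes V: "subspace V" and "finite V"
  shows "card {P. subspace P \<and> dim P = 1 \<and> P \<subseteq> V} * (CARD('a) - 1) = CARD('a) ^ dim V - 1"
proof -
  let ?A = "{P. subspace P \<and> dim P = 1 \<and> P \<subseteq> V}"
  have "card {v \<in> V - {0}. v \<in> P} = CARD('a) - 1" if "P \<in> ?A" for P
  proof -
    have "{v \<in> V - {0}. v \<in> P} = P - {0}" using that by auto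
    then show ?thesis
      using that card_subspace[of P] by (simp add: card_Diff_singleton subspace_0)
  qed
  moreover have "card {P \<in> ?A. v \<in> P} = 1" if "v \<in> V - {0}" for v
  proof -
    have "{P \<in> ?A. v \<in> P} = {span {v}}"
      using that V one_dim_subspace_eq_span span_minimal[of "{v}" V] by (auto intro: span_base)
    then show ?thesis by simp
  qed
  moreover have "finite ?A" using \<open>finite V\<close> by (intro finite_subset[of ?A "Pow V"]) auto
  ultimately have "card ?A * (CARD('a) - 1) = card (V - {0})"
    using sum_multicount[of ?A "V - {0}" "\<lambda>P v. v \<in> P" 1] \<open>finite V\<close> by simp
  also have "\<dots> = CARD('a) ^ dim V - 1"
    using V by (simp add: card_Diff_singleton subspace_0 card_subspace)
  finally show ?thesis .
qed

lemma card_one_dim_subspaces: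
  assumes finite_field: "finite (UNIV :: 'a set)" and V: "subspace V"
  shows "card {P. subspace P \<and> dim P = 1 \<and> P \<subseteq> V} = (\<Sum>i<dim V. CARD('a) ^ i)"
    (is "card ?A = _")
proof -
  have "card {0, 1 :: 'a} \<le> CARD('a)" using finite_field by (intro card_mono) auto
  then have q: "CARD('a) \<ge> 2" by simp
  then have "card V > 0" using V by (simp add: card_subspace)
  then have "card ?A * (CARD('a) - 1) = CARD('a) ^ dim V - 1"
    using card_one_dim_subspaces_mult[OF V] card_ge_0_finite by blast
  from arg_cong[OF this, of int]
  have "int (card ?A) * (int CARD('a) - 1) = int CARD('a) ^ dim V - 1"
    using q by (simp add: of_nat_diff)
  also have "\<dots> = (\<Sum>i<dim V. int CARD('a) ^ i) * (int CARD('a) - 1)"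
    by (simp add: power_diff_1_eq)
  finally have "int (card ?A) = int (\<Sum>i<dim V. CARD('a) ^ i)"
    using q by simp
  then show ?thesis by (simp only: of_nat_eq_iff)
qed

end

subsection \<open>Finite linear spaces and projective planes\<close>

locale finite_linear_space =
  fixes points :: "'p set" and lines :: "'l set" and incident :: "'p \<Rightarrow> 'l \<Rightarrow> bool"
  assumes finite_points: "finite points"
    and finite_lines: "finite lines"
    and ex1_line: "\<lbrakk>P \<in> points; Q \<in> points; P \<noteq> Q\<rbrakk> \<Longrightarrow> \<exists>!L. L \<in> lines \<and> incident P L \<and> incident Q L"
begin

definition lines_through :: "'p \<Rightarrow> 'l set" where
  "lines_through P = {L \<in> lines. incident P L}"

definition intersection_number :: "'p set \<Rightarrow> 'l \<Rightarrow> nat" where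
  "intersection_number S L = card {P \<in> S. incident P L}"

definition secants :: "nat \<Rightarrow> 'p set \<Rightarrow> 'l set" where
  "secants i S = {L \<in> lines. intersection_number S L = i}"

lemma sum_intersection_number:
  assumes "S \<subseteq> points"
  shows "(\<Sum>L\<in>lines. intersection_number S L) = (\<Sum>P\<in>S. card (lines_through P))"
  unfolding intersection_number_def lines_through_def
  using finite_lines finite_subset[OF assms finite_points] by (intro sum_multicount_gen) auto

lemma sum_intersection_number_lines_through:
  assumes "P \<in> points" "S \<subseteq> points"
  shows "(\<Sum>L\<in>lines_through P. intersection_number (S - {P}) L) = card (S - {P})"
proof -
  have "card {L \<in> lines_through P. incident Q L} = 1" if "Q \<in> S - {P}" for Q
  proof -
    have "\<exists>!L. L \<in> lines \<and> incident P L \<and> incident Q L"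
      using assms that by (intro ex1_line) auto
    then show ?thesis by (auto simp: lines_through_def card_1_singleton_iff)
  qed
  then show ?thesis
    unfolding intersection_number_def
    using finite_lines finite_subset[OF assms(2) finite_points]
    by (subst sum_multicount[where k = 1]) (auto simp: lines_through_def)
qed

lemma intersection_number_remove:
  assumes "P \<in> S" "incident P L"
  shows "intersection_number (S - {P}) L = intersection_number S L - 1"
proof -
  have "{Q \<in> S - {P}. incident Q L} = {Q \<in> S. incident Q L} - {P}" by blast
  then show ?thesis using assms by (simp add: intersection_number_def card_Diff_singleton)
qed

lemma sum_intersection_number_pairs:
  assumes "S \<subseteq> points"
  shows "(\<Sum>L\<in>lines. intersection_number S L * (intersection_number S L - 1)) = card S * (card S - 1)"
proof -
  have "finite S" using assms finite_points by (rule finite_subset)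
  have "(\<Sum>L\<in>lines. intersection_number S L * (intersection_number S L - 1))
      = (\<Sum>L\<in>lines. \<Sum>P | P \<in> S \<and> incident P L. intersection_number (S - {P}) L)"
    by (simp add: intersection_number_remove) (simp add: intersection_number_def)
  also have "\<dots> = (\<Sum>P\<in>S. \<Sum>L\<in>lines_through P. intersection_number (S - {P}) L)"
    unfolding lines_through_def using finite_lines \<open>finite S\<close> by (rule sum.swap_restrict)
  also have "\<dots> = (\<Sum>P\<in>S. card S - 1)"
    using assms by (intro sum.cong)
      (simp_all add: sum_intersection_number_lines_through card_Diff_singleton subset_iff)
  finally show ?thesis by simp
qed

lemma card_lines_through_mult:
  assumes "\<And>L. L \<in> lines \<Longrightarrow> intersection_number points L = k" and "P \<in> points"
  shows "card (lines_through P) * (k - 1) = card points - 1"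
proof -
  have "(\<Sum>L\<in>lines_through P. intersection_number (points - {P}) L) = (\<Sum>L\<in>lines_through P. k - 1)"
    using assms by (intro sum.cong) (auto simp: lines_through_def intersection_number_remove)
  then show ?thesis
    using sum_intersection_number_lines_through[OF assms(2) order_refl] assms(2)
    by (simp add: card_Diff_singleton)
qed

lemma sum_lines_eq_sum_secants:
  assumes "\<And>L. L \<in> lines \<Longrightarrow> intersection_number S L \<le> k"
  shows "(\<Sum>L\<in>lines. f (intersection_number S L))
    = (\<Sum>i\<le>k. of_nat (card (secants i S)) * f i :: 'r :: semiring_1)"
  unfolding secants_def using finite_lines assms by (intro sum_fun_comp) auto

end

locale finite_projective_plane = finite_linear_space +
  fixes order :: nat
  assumes order_pos: "order > 0"
    and card_points: "card points = order\<^sup>2 + order + 1"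
    and card_points_on_line: "L \<in> lines \<Longrightarrow> intersection_number points L = order + 1"
begin

lemma card_lines_through:
  assumes "P \<in> points"
  shows "card (lines_through P) = order + 1"
proof -
  have "card (lines_through P) * order = (order + 1) * order"
    using card_lines_through_mult[OF card_points_on_line assms]
    by (simp add: card_points power2_eq_square)
  then show ?thesis using order_pos by (simp only: mult_cancel2) simp
qed

lemma card_lines: "card lines = order\<^sup>2 + order + 1"
proof -
  have "card lines * (order + 1) = (order\<^sup>2 + order + 1) * (order + 1)"
    using sum_intersection_number[OF order_refl]
    by (simp add: card_points_on_line card_lines_through card_points)
  then show ?thesis by (simp only: mult_cancel2) simp
qed

lemma sum_intersection_number_quadratic:
  fixes k :: real
  assumes "S \<subseteq> points"
  defines "s \<equiv> real (card S)" and "q \<equiv> real order"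
  shows "(\<Sum>L\<in>lines. (1 - real (intersection_number S L)) * (k - real (intersection_number S L)))
    = k * (q\<^sup>2 + q + 1) - k * (s * (q + 1)) + s * (s - 1)"
proof -
  define n where "n L = real (intersection_number S L)" for L
  have real_mult_pred: "real (m * (m - 1)) = real m * (real m - 1)" for m
    by (cases m) (simp_all add: algebra_simps)
  have num_lines: "real (card lines) = q\<^sup>2 + q + 1"
    by (simp add: card_lines q_def)
  have "(\<Sum>L\<in>lines. intersection_number S L) = card S * (order + 1)"
    using sum_intersection_number[OF assms(1)] assms(1)
    by (simp add: card_lines_through subset_iff)
  then have flags: "(\<Sum>L\<in>lines. n L) = s * (q + 1)"
    unfolding n_def s_def q_def of_nat_sum[symmetric] by (simp add: algebra_simps)
  have pairs: "(\<Sum>L\<in>lines. n L * (n L - 1)) = s * (s - 1)"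
    using arg_cong[OF sum_intersection_number_pairs[OF assms(1)], of real]
    unfolding of_nat_sum real_mult_pred n_def s_def .
  have "(\<Sum>L\<in>lines. (1 - n L) * (k - n L)) = (\<Sum>L\<in>lines. k - k * n L + n L * (n L - 1))"
    by (simp add: algebra_simps)
  also have "\<dots> = k * real (card lines) - k * (\<Sum>L\<in>lines. n L) + (\<Sum>L\<in>lines. n L * (n L - 1))"
    by (simp add: sum.distrib sum_subtractf sum_distrib_left)
  also have "\<dots> = k * (q\<^sup>2 + q + 1) - k * (s * (q + 1)) + s * (s - 1)"
    by (simp only: num_lines flags pairs)
  finally show ?thesis unfolding n_def .
qed

lemma external_lines_identity:
  assumes "S \<subseteq> points" and "\<And>L. L \<in> lines \<Longrightarrow> intersection_number S L \<le> k"
  defines "s \<equiv> real (card S)" and "q \<equiv> real order"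
  shows "real k * card (secants 0 S) = k * (q\<^sup>2 + q + 1) - k * (s * (q + 1)) + s * (s - 1)
    + (\<Sum>i=1..k. (real i - 1) * (real k - real i) * card (secants i S))"
proof -
  let ?p = "\<lambda>i. (1 - real i) * (real k - real i)"
  have "real k * (q\<^sup>2 + q + 1) - k * (s * (q + 1)) + s * (s - 1)
      = (\<Sum>L\<in>lines. ?p (intersection_number S L))"
    unfolding s_def q_def using assms(1) by (simp add: sum_intersection_number_quadratic)
  also have "\<dots> = (\<Sum>i\<le>k. card (secants i S) * ?p i)"
    using assms(2) by (rule sum_lines_eq_sum_secants)
  also have "\<dots> = real k * card (secants 0 S) + (\<Sum>i=1..k. card (secants i S) * ?p i)"
    by (simp add: atMost_atLeast0 sum.atLeast_Suc_atMost)
  also have "(\<Sum>i=1..k. card (secants i S) * ?p i)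
      = - (\<Sum>i=1..k. (real i - 1) * (real k - real i) * card (secants i S))"
    unfolding sum_negf[symmetric] by (intro sum.cong) (simp_all add: algebra_simps)
  finally show ?thesis by simp
qed

end

subsection \<open>The plane over a finite field\<close>

lemma card_pg_points:
  "card (pg_points :: (('a::{field,finite}) ^ 3) set set) = CARD('a)\<^sup>2 + CARD('a) + 1"
  using vec.card_one_dim_subspaces[of "UNIV :: ('a ^ 3) set"]
  by (simp add: pg_points_def card_cart_basis numeral_3_eq_3 power2_eq_square)

lemma card_pg_points_on_line:
  fixes L :: "(('a::{field,finite}) ^ 3) set"
  assumes "L \<in> pg_lines"
  shows "card {P \<in> pg_points. P \<subseteq> L} = CARD('a) + 1"
  using assms vec.card_one_dim_subspaces[of L]
  by (simp add: pg_points_def pg_lines_def numeral_2_eq_2)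

interpretation pg: finite_linear_space
  "pg_points :: (('a::{field,finite}) ^ 3) set set" pg_lines "(\<subseteq>)"
proof
  fix P Q :: "('a ^ 3) set"
  assume "P \<in> pg_points" "Q \<in> pg_points" "P \<noteq> Q"
  then show "\<exists>!L. L \<in> pg_lines \<and> P \<subseteq> L \<and> Q \<subseteq> L"
    using vec.ex1_two_dim_subspace[of P Q] by (simp add: pg_points_def pg_lines_def)
qed auto

interpretation pg: finite_projective_plane
  "pg_points :: (('a::{field,finite}) ^ 3) set set" pg_lines "(\<subseteq>)" "CARD('a)"
  by unfold_locales
    (auto simp: card_pg_points card_pg_points_on_line pg.intersection_number_def)

lemma num_secants_eq_card_secants: "num_secants i S = card (pg.secants i S)"
  by (simp add: num_secants_def pg.secants_def pg.intersection_number_def)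

lemma intersection_number_le_pg_degree:
  fixes S :: "(('a::{field,finite}) ^ 3) set set"
  assumes "L \<in> pg_lines"
  shows "pg.intersection_number S L \<le> pg_degree S"
proof -
  have "{i. num_secants i S \<noteq> 0} = pg.intersection_number S ` pg_lines"
    by (auto simp: num_secants_eq_card_secants pg.secants_def)
  then show ?thesis unfolding pg_degree_def using assms by simp
qed

lemma pg_external_lines_identity:
  fixes S :: "(('a::{field,finite}) ^ 3) set set"
  assumes "S \<subseteq> pg_points" "card S = CARD('a) + 1" "pg_degree S \<le> k"
  shows "real k * num_secants 0 S = real CARD('a) * (real CARD('a) + 1 - k)
    + (\<Sum>i=1..k. (real i - 1) * (real k - real i) * num_secants i S)"
proof -
  have "pg.intersection_number S L \<le> k" if "L \<in> pg_lines" for L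
    using intersection_number_le_pg_degree[OF that] assms(3) by (rule order_trans)
  from pg.external_lines_identity[OF assms(1) this] show ?thesis
    unfolding num_secants_eq_card_secants assms(2)
    by (simp add: algebra_simps power2_eq_square)
qed

theorem theorem4p16:
  fixes S :: "(('a::{field,finite}) ^ 3) set set" and q :: nat
  assumes "CARD('a) = q"
    and "S \<subseteq> pg_points"
    and "card S = q + 1"
  shows "(pg_degree S \<le> 3 \<longrightarrow>
            real (num_secants 0 S) \<ge> real q * (real q - 2) / 3) \<and>
         (\<forall>c. pg_degree S \<le> 4 \<and> num_secants 3 S = c \<longrightarrow>
            real (num_secants 0 S) \<ge> ((real q)\<^sup>2 - 3 * real q + 2 * real c) / 4)"
proof (intro conjI impI allI)
  note identity = pg_external_lines_identity[OF assms(2) assms(3)[folded assms(1)], unfolded assms(1)]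
  show "real (num_secants 0 S) \<ge> real q * (real q - 2) / 3" if "pg_degree S \<le> 3"
  proof -
    have "3 * real (num_secants 0 S) = real q * (real q - 2) + num_secants 2 S"
      using identity[OF that] by (simp add: numeral_eq_Suc sum.atLeast_Suc_atMost)
    then show ?thesis by simp
  qed
  show "real (num_secants 0 S) \<ge> ((real q)\<^sup>2 - 3 * real q + 2 * real c) / 4"
    if "pg_degree S \<le> 4 \<and> num_secants 3 S = c" for c
  proof -
    have "4 * real (num_secants 0 S) = real q * (real q - 3) + 2 * num_secants 2 S + 2 * real c"
      using identity[of 4] that by (simp add: numeral_eq_Suc sum.atLeast_Suc_atMost)
    then show ?thesis by (simp add: algebra_simps power2_eq_square)
  qed
qed

end
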